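(* For $k\ge1$ let $\mathbf{g}\sim\mathsf{N}(0,\mathrm{I}_k/k)$ and $\alpha_k=(\mathbb{E}\|\mathbf{g}\|_2)^2$. Then for every symmetric matrix $\mathbf{M}\in\mathbb{R}^{n\times n}$, $$\mathrm{SDP}(\mathbf{M})\ge\mathrm{OPT}_k(\mathbf{M})\ge\alpha_k\,\mathrm{SDP}(\mathbf{M})-(1-\alpha_k)\,\mathrm{SDP}(-\mathbf{M}),$$ and $$\mathrm{OPT}_k(\mathbf{M})\ge(2-\alpha_k^{-1})\,\mathrm{SDP}(\mathbf{M})-(\alpha_k^{-1}-1)\,\mathrm{OPT}_k(-\mathbf{M}).$$
   Context: $\mathrm{SDP}(\mathbf{M})=\max\{\langle\mathbf{M},\mathbf{X}\rangle:\ \mathbf{X}\succeq0,\ X_{ii}=1\ \forall i\in[n]\}$ with $\langle\mathbf{A},\mathbf{B}\rangle=\mathrm{Tr}(\mathbf{A}^{\mathsf T}\mathbf{B})$. $\mathrm{OPT}_k(\mathbf{M})=\max\{\langle\mathbf{M},\mathbf{X}\rangle:\ \mathbf{X}\succeq0,\ X_{ii}=1\ \forall i,\ \mathrm{rank}(\mathbf{X})\le k\}=\max\{\sum_{i,j=1}^nM_{ij}\langle\boldsymbol\sigma_i,\boldsymbol\sigma_j\rangle:\ \boldsymbol\sigma_i\in\mathbb{S}^{k-1}\}$, where $\mathbb{S}^{k-1}$ is the unit sphere in $\mathbb{R}^k$. *)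

theory Defs
  imports "HOL-Probability.Probability"
begin

definition psd :: "real^'n^'n \<Rightarrow> bool" where
  "psd X \<longleftrightarrow> transpose X = X \<and> (\<forall>v. 0 \<le> v \<bullet> (X *v v))"

definition mat_inner :: "real^'n^'n \<Rightarrow> real^'n^'n \<Rightarrow> real" where
  "mat_inner A B = trace (transpose A ** B)"

definition elliptope :: "(real^'n^'n) set" where
  "elliptope = {X. psd X \<and> (\<forall>i. X $ i $ i = 1)}"

text \<open>The suprema below are maxima: see \<open>SDP_attained\<close> and \<open>OPT_attained\<close>.\<close>

definition SDP :: "real^'n^'n \<Rightarrow> real" where
  "SDP M = (SUP X \<in> elliptope. mat_inner M X)"

definition OPT :: "nat \<Rightarrow> real^'n^'n \<Rightarrow> real" where
  "OPT k M = (SUP X \<in> {X \<in> elliptope. rank X \<le> k}. mat_inner M X)"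

text \<open>The law \<open>N(0, I/k)\<close> on \<open>k\<close>-dimensional space, whose vectors are functions on \<open>{..<k}\<close>;
  the second parameter of \<^const>\<open>normal_density\<close> is the standard deviation.\<close>

definition gaussian_vec :: "nat \<Rightarrow> (nat \<Rightarrow> real) measure" where
  "gaussian_vec k =
     (\<Pi>\<^sub>M i\<in>{..<k}. density lborel (\<lambda>x. ennreal (normal_density 0 (1 / sqrt (real k)) x)))"

definition alpha :: "nat \<Rightarrow> real" where
  "alpha k = (LINT g|gaussian_vec k. L2_set g {..<k})\<^sup>2"

lemma mat_inner_eq_sum: "mat_inner A B = (\<Sum>i\<in>UNIV. \<Sum>j\<in>UNIV. A $ i $ j * B $ i $ j)"
proof -
  have "mat_inner A B = (\<Sum>j\<in>UNIV. \<Sum>i\<in>UNIV. A $ i $ j * B $ i $ j)"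
    by (simp add: mat_inner_def trace_def matrix_matrix_mult_def transpose_def)
  then show ?thesis by (subst sum.swap)
qed

lemma closed_elliptope: "closed (elliptope :: (real^'n^'n) set)"
proof -
  have eq: "(elliptope :: (real^'n^'n) set) =
      (\<Inter>i. \<Inter>j. {X. X $ j $ i = X $ i $ j}) \<inter> (\<Inter>v. {X. 0 \<le> v \<bullet> (X *v v)}) \<inter> (\<Inter>i. {X. X $ i $ i = 1})"
    by (auto simp: elliptope_def psd_def transpose_def vec_eq_iff)
  show ?thesis
    unfolding eq matrix_vector_mult_def
    by (intro closed_Int closed_INT ballI closed_Collect_eq closed_Collect_le continuous_intros)
qed

lemma inner_matrix_vector_eq_sum: "v \<bullet> (X *v v) = (\<Sum>i\<in>UNIV. \<Sum>j\<in>UNIV. X $ i $ j * v $ i * v $ j)"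
  for X :: "real^'n^'n"
  by (simp add: inner_vec_def matrix_vector_mult_def sum_distrib_left mult_ac)

lemma elliptope_entry_le:
  fixes X :: "real^'n^'n"
  assumes "X \<in> elliptope" shows "\<bar>X $ i $ j\<bar> \<le> 1"
proof (cases "i = j")
  case True
  then show ?thesis using assms by (auto simp: elliptope_def)
next
  case False
  have sym: "X $ j $ i = X $ i $ j" and diag: "X $ i $ i = 1" "X $ j $ j = 1"
    and nn: "0 \<le> v \<bullet> (X *v v)" for v
    using assms by (auto simp: elliptope_def psd_def transpose_def vec_eq_iff)
  have *: "axis a 1 \<bullet> (X *v axis b 1) = X $ a $ b" for a b
    by (simp add: matrix_vector_mult_basis inner_axis' column_def)
  have "0 \<le> 2 + 2 * X $ i $ j"
    using nn[of "axis i 1 + axis j 1"] sym diag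
    by (simp add: matrix_vector_right_distrib inner_add_left inner_add_right *)
  moreover have "0 \<le> 2 - 2 * X $ i $ j"
    using nn[of "axis i 1 - axis j 1"] sym diag
    by (simp add: matrix_vector_mult_diff_distrib inner_diff_left inner_diff_right *)
  ultimately show ?thesis by linarith
qed

lemma compact_elliptope: "compact (elliptope :: (real^'n^'n) set)"
proof -
  have "norm X \<le> real (CARD('n) * CARD('n))" if "X \<in> elliptope" for X :: "real^'n^'n"
  proof -
    have row: "norm (X $ i) \<le> real CARD('n)" for i
    proof -
      have "norm (X $ i) \<le> (\<Sum>j\<in>UNIV. \<bar>X $ i $ j\<bar>)" by (rule norm_le_l1_cart)
      also have "\<dots> \<le> (\<Sum>j\<in>(UNIV::'n set). 1)" by (intro sum_mono elliptope_entry_le that)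
      finally show ?thesis by simp
    qed
    have "norm X \<le> (\<Sum>i\<in>UNIV. norm (X $ i))"
      unfolding norm_vec_def by (rule L2_set_le_sum) auto
    also have "\<dots> \<le> (\<Sum>i\<in>(UNIV::'n set). real CARD('n))" by (intro sum_mono row)
    finally show ?thesis by simp
  qed
  then show ?thesis
    using closed_elliptope by (auto simp: compact_eq_bounded_closed bounded_iff)
qed

lemma closed_rank_le: "closed {X :: real^'n^'m. rank X \<le> k}"
proof -
  have "open {X :: real^'n^'m. k < rank X}"
    unfolding open_dist
  proof safe
    fix X :: "real^'n^'m" assume k: "k < rank X"
    have dimS: "dim (span (rows X)) = rank X" by (simp add: row_rank_def)
    have "\<exists>e>0. \<forall>x\<in>span (rows X). norm (X *v x) \<ge> e * norm x"
      using nullspace_inter_rowspace[of X]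
      by (intro injective_imp_isometric closed_subspace)
         (auto intro: matrix_vector_mul_bounded_linear)
    then obtain e where e: "e > 0" "\<And>x. x \<in> span (rows X) \<Longrightarrow> norm (X *v x) \<ge> e * norm x"
      by blast
    show "\<exists>d>0. \<forall>Y. dist Y X < d \<longrightarrow> Y \<in> {X :: real^'n^'m. k < rank X}"
      unfolding mem_Collect_eq
    proof (intro exI[of _ e] conjI allI impI)
      show "0 < e" by fact
      fix Y :: "real^'n^'m" assume Y: "dist Y X < e"
      have inj: "inj_on ((*v) Y) (span (rows X))"
      proof (rule inj_onI)
        fix x y assume xy: "x \<in> span (rows X)" "y \<in> span (rows X)" "Y *v x = Y *v y"
        define z where "z = x - y"
        have z: "z \<in> span (rows X)" "Y *v z = 0"
          using xy by (auto simp: z_def span_diff matrix_vector_mult_diff_distrib)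
        have bnd: "norm ((X - Y) *v z) \<le> norm (X - Y) * norm z"
        proof -
          have "norm ((X - Y) *v z) = L2_set (\<lambda>i. norm (((X - Y) $ i) \<bullet> z)) UNIV"
            by (simp add: norm_vec_def matrix_vector_mul_component)
          also have "\<dots> \<le> L2_set (\<lambda>i. norm z * norm ((X - Y) $ i)) UNIV"
            by (intro L2_set_mono) (auto simp: Cauchy_Schwarz_ineq2 mult.commute[of "norm z"])
          also have "\<dots> = norm z * norm (X - Y)"
            by (subst L2_set_right_distrib[symmetric]) (auto simp: norm_vec_def)
          finally show ?thesis by (simp add: mult.commute)
        qed
        have "e * norm z \<le> norm (X *v z)" using e z by blast
        also have "X *v z = (X - Y) *v z" using z by (simp add: matrix_vector_mult_diff_rdistrib)
        also note bnd
        finally have "e * norm z \<le> norm (X - Y) * norm z" .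
        moreover have "norm (X - Y) < e" using Y by (simp add: dist_norm norm_minus_commute)
        ultimately have "norm z = 0"
          by (metis mult_le_cancel_right not_less norm_ge_zero order_le_less)
        then show "x = y" by (simp add: z_def)
      qed
      have "rank X = dim ((*v) Y ` span (rows X))"
        using dim_image_eq[of "(*v) Y" "span (rows X)"] inj dimS by (simp add: span_span)
      also have "\<dots> \<le> rank Y"
        unfolding rank_dim_range by (intro dim_subset) auto
      finally show "k < rank Y" using k by simp
    qed
  qed
  moreover have "- {X :: real^'n^'m. rank X \<le> k} = {X. k < rank X}" by auto
  ultimately show ?thesis by (simp add: closed_def)
qed

lemma compact_elliptope_rank: "compact {X \<in> (elliptope :: (real^'n^'n) set). rank X \<le> k}"
  using compact_Int_closed[OF compact_elliptope closed_rank_le] by (simp add: Int_def)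

lemma elliptope_rank_nonempty:
  assumes "k \<ge> 1" shows "\<exists>X \<in> (elliptope :: (real^'n^'n) set). rank X \<le> k"
proof
  let ?J = "(\<chi> i j. 1) :: real^'n^'n"
  have "v \<bullet> (?J *v v) = (\<Sum>i\<in>UNIV. v $ i)\<^sup>2" for v
    by (simp add: inner_matrix_vector_eq_sum power2_eq_square sum_product)
  then show "?J \<in> elliptope"
    by (auto simp: elliptope_def psd_def transpose_def vec_eq_iff)
  have "rows ?J \<subseteq> {\<chi> j. 1}" by (auto simp: rows_def row_def)
  then have "dim (rows ?J) \<le> card {(\<chi> j. 1) :: real^'n}"
    by (intro dim_le_card) (auto intro: span_base)
  then show "rank ?J \<le> k" using assms by (simp add: row_rank_def)
qed

lemma SUP_attained:
  fixes f :: "'a::topological_space \<Rightarrow> real"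
  assumes "compact S" "S \<noteq> {}" "continuous_on S f"
  shows "\<exists>x\<in>S. (\<forall>y\<in>S. f y \<le> f x) \<and> f x = (SUP x\<in>S. f x)"
proof -
  obtain x where x: "x \<in> S" "\<forall>y\<in>S. f y \<le> f x"
    using continuous_attains_sup[OF assms] by blast
  then have "(SUP x\<in>S. f x) = f x"
    by (intro cSup_eq_maximum) auto
  with x show ?thesis by auto
qed

lemma continuous_on_mat_inner: "continuous_on S (mat_inner M)"
  unfolding mat_inner_eq_sum by (intro continuous_intros)

theorem SDP_attained:
  fixes M :: "real^'n^'n"
  shows "\<exists>X\<in>elliptope. (\<forall>Y\<in>elliptope. mat_inner M Y \<le> mat_inner M X) \<and> mat_inner M X = SDP M"
  unfolding SDP_def
  using elliptope_rank_nonempty[of 1, where 'n='n]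
  by (intro SUP_attained compact_elliptope continuous_on_mat_inner) auto

theorem OPT_attained:
  fixes M :: "real^'n^'n"
  assumes "k \<ge> 1"
  shows "\<exists>X\<in>{X \<in> elliptope. rank X \<le> k}.
    (\<forall>Y\<in>{X \<in> elliptope. rank X \<le> k}. mat_inner M Y \<le> mat_inner M X) \<and> mat_inner M X = OPT k M"
  unfolding OPT_def
  using elliptope_rank_nonempty[OF assms]
  by (intro SUP_attained compact_elliptope_rank continuous_on_mat_inner) auto

end

theory Submission
  imports Defs
begin

text \<open>Rietz's method. Factor an optimal \<open>X\<close> for \<open>SDP M\<close> as \<open>X\<^sub>i\<^sub>j = s\<^sub>i \<bullet> s\<^sub>j\<close> with unit
  vectors \<open>s\<^sub>i\<close>, let \<open>G\<close> be an \<open>n \<times> k\<close> matrix with independent \<open>N(0, 1/k)\<close> entries, and put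
  \<open>x\<^sub>i = G\<^sup>T s\<^sub>i\<close> and \<open>u\<^sub>i = x\<^sub>i / \<parallel>x\<^sub>i\<parallel>\<close>. Rotation invariance gives
  \<open>E (x\<^sub>i \<bullet> x\<^sub>j) = X\<^sub>i\<^sub>j\<close> and \<open>E (u\<^sub>i \<bullet> x\<^sub>j) = \<surd>\<alpha> X\<^sub>i\<^sub>j\<close>, so that
  \<open>E (u\<^sub>i \<bullet> u\<^sub>j) - \<alpha> X\<^sub>i\<^sub>j = E ((u\<^sub>i - \<surd>\<alpha> x\<^sub>i) \<bullet> (u\<^sub>j - \<surd>\<alpha> x\<^sub>j))\<close> is positive semidefinite with
  diagonal \<open>1 - \<alpha>\<close>. Pairing it with \<open>- M\<close> gives the first lower bound; the second follows from the
  first by bounding \<open>SDP (- M)\<close> with the first applied to \<open>- M\<close>.\<close>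

section \<open>Isotropic Gaussian measures\<close>

lemma nn_integral_lborel_translate:
  fixes f :: "'a::euclidean_space \<Rightarrow> ennreal"
  assumes [measurable]: "f \<in> borel_measurable borel"
  shows "(\<integral>\<^sup>+x. f (c + x) \<partial>lborel) = (\<integral>\<^sup>+x. f x \<partial>lborel)"
proof -
  have "(\<integral>\<^sup>+x. f x \<partial>lborel) = (\<integral>\<^sup>+x. f x \<partial>distr lborel borel ((+) c))"
    by (simp add: lborel_distr_plus)
  then show ?thesis by (simp add: nn_integral_distr)
qed

text \<open>Integrating the indicator of \<open>T x \<in> A\<close>, \<open>y \<in> B\<close> for the unit ball \<open>B\<close> needs only
  translations and Fubini, because \<open>B\<close> is invariant under \<open>T\<close>.\<close>
lemma distr_lborel_orthogonal_transformation:
  fixes T :: "'a::euclidean_space \<Rightarrow> 'a"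
  assumes T: "orthogonal_transformation T"
  shows "distr lborel borel T = lborel"
proof (rule measure_eqI)
  have lin: "linear T" using T by (simp add: orthogonal_transformation_linear)
  note [measurable] = borel_measurable_continuous_onI[OF linear_continuous_on[OF linear_conv_bounded_linear[THEN iffD1, OF lin]]]
  fix A assume "A \<in> sets (distr lborel borel T)"
  then have [measurable]: "A \<in> sets borel" by simp
  define B where "B = ball (0::'a) 1"
  have [measurable]: "B \<in> sets borel" by (simp add: B_def)
  have B: "- x \<in> B \<longleftrightarrow> x \<in> B" "T x \<in> B \<longleftrightarrow> x \<in> B" for x
    using T by (auto simp: B_def orthogonal_transformation_norm)
  \<comment> \<open>A right inverse \<open>S\<close> writes the translation by \<open>y\<close> as
    \<open>T (S y)\<close>, so that the ball condition on \<open>- T x + y\<close> becomes one on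
    \<open>S y - x\<close>.\<close>
  obtain S where S: "\<And>y. T (S y) = y"
    using orthogonal_transformation_surj[OF T] by (metis surj_def)
  have eq: "indicator B (- T x + y) = (indicator B (S y - x) :: ennreal)" for x y
  proof -
    have "- T x + y = T (S y - x)" by (simp add: linear_diff[OF lin] S)
    then show ?thesis by (simp add: B indicator_def)
  qed
  have "emeasure lborel (T -` A) * emeasure lborel B =
      (\<integral>\<^sup>+x. (\<integral>\<^sup>+y. indicator A (T x) * indicator B y \<partial>lborel) \<partial>lborel)"
    using measurable_sets[of T borel borel A]
    by (simp add: nn_integral_cmult nn_integral_multc indicator_vimage[unfolded comp_def, symmetric])
  also have "\<dots> = (\<integral>\<^sup>+x. (\<integral>\<^sup>+y. indicator A (T x) * indicator B (- T x + y) \<partial>lborel) \<partial>lborel)"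
    by (intro nn_integral_cong nn_integral_lborel_translate[symmetric]) measurable
  also have "\<dots> = (\<integral>\<^sup>+y. (\<integral>\<^sup>+x. indicator A (T x) * indicator B (- T x + y) \<partial>lborel) \<partial>lborel)"
    by (rule lborel_pair.Fubini') measurable
  also have "\<dots> = (\<integral>\<^sup>+y. (\<integral>\<^sup>+x. indicator A (T x + y) * indicator B x \<partial>lborel) \<partial>lborel)"
  proof (rule nn_integral_cong)
    fix y
    \<comment> \<open>Substituting \<open>S y + x\<close> for \<open>x\<close> turns the ball
      condition into \<open>- x \<in> B\<close>, that is \<open>x \<in> B\<close>, and turns
      \<open>T x\<close> into \<open>y + T x\<close>.\<close>
    have "(\<integral>\<^sup>+x. indicator A (T x) * indicator B (S y - x) \<partial>lborel) =
        (\<integral>\<^sup>+x. indicator A (T (S y + x)) * indicator B (S y - (S y + x)) \<partial>lborel)"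
      by (rule nn_integral_lborel_translate[symmetric]) measurable
    then show "(\<integral>\<^sup>+x. indicator A (T x) * indicator B (- T x + y) \<partial>lborel) =
        (\<integral>\<^sup>+x. indicator A (T x + y) * indicator B x \<partial>lborel)"
      unfolding eq by (simp add: linear_add[OF lin] S B add.commute indicator_def)
  qed
  also have "\<dots> = (\<integral>\<^sup>+x. (\<integral>\<^sup>+y. indicator A (T x + y) * indicator B x \<partial>lborel) \<partial>lborel)"
    by (rule lborel_pair.Fubini') measurable
  also have "\<dots> = (\<integral>\<^sup>+x. (\<integral>\<^sup>+y. indicator A y * indicator B x \<partial>lborel) \<partial>lborel)"
    by (intro nn_integral_cong nn_integral_lborel_translate) measurable
  also have "\<dots> = emeasure lborel A * emeasure lborel B"
    by (simp add: nn_integral_cmult nn_integral_multc)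
  finally have "emeasure lborel (T -` A) * emeasure lborel B = emeasure lborel A * emeasure lborel B" .
  \<comment> \<open>The ball has positive finite volume, so the common factor cancels in
    \<open>ennreal\<close>.\<close>
  moreover have "emeasure lborel B \<noteq> 0" "emeasure lborel B \<noteq> \<infinity>"
    using content_ball_pos[of 1 "0::'a"] emeasure_lborel_ball_finite[of "0::'a" 1] by (auto simp: B_def measure_def)
  ultimately show "emeasure (distr lborel borel T) A = emeasure lborel A"
    by (auto simp: emeasure_distr mult.commute[of _ "emeasure lborel B"] ennreal_mult_cancel_left)
qed simp

section \<open>The rotation-invariant Gaussian law and its one-dimensional projections\<close>

text \<open>For \<sigma> > 0 this is the centred normal law with covariance \<sigma>^2 times the
  identity. As a density on the Euclidean space itself, rather than a product over coordinates, it
  can be pushed forward along orthogonal maps directly.\<close>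

definition isotropic_gaussian :: "real \<Rightarrow> 'a::euclidean_space measure" where
  "isotropic_gaussian \<sigma> = density lborel (\<lambda>x. ennreal (\<Prod>b\<in>Basis. normal_density 0 \<sigma> (x \<bullet> b)))"

lemma space_isotropic_gaussian [simp]: "space (isotropic_gaussian \<sigma>) = UNIV"
  and sets_isotropic_gaussian [simp, measurable_cong]: "sets (isotropic_gaussian \<sigma>) = sets borel"
  by (simp_all add: isotropic_gaussian_def)

text \<open>Exponents of the coordinate densities add up to the squared norm, which makes the
  rotation invariance of the density visible.\<close>

lemma isotropic_gaussian_density_eq:
  fixes x :: "'a::euclidean_space"
  shows "(\<Prod>b\<in>Basis. normal_density 0 \<sigma> (x \<bullet> b)) =
    (1 / sqrt (2 * pi * \<sigma>\<^sup>2)) ^ DIM('a) * exp (- (norm x)\<^sup>2 / (2 * \<sigma>\<^sup>2))"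
proof -
  have "(\<Prod>b\<in>Basis. exp (- (x \<bullet> b)\<^sup>2 / (2 * \<sigma>\<^sup>2))) = exp (- (norm x)\<^sup>2 / (2 * \<sigma>\<^sup>2))"
    unfolding power2_norm_eq_inner euclidean_inner[of x x]
    by (simp add: exp_sum[symmetric] power2_eq_square sum_negf sum_divide_distrib)
  then show ?thesis by (simp only: normal_density_def prod.distrib prod_constant diff_0_right)
qed

lemma distr_isotropic_gaussian_orthogonal_transformation:
  fixes T :: "'a::euclidean_space \<Rightarrow> 'a"
  assumes "orthogonal_transformation T"
  shows "distr (isotropic_gaussian \<sigma>) borel T = isotropic_gaussian \<sigma>"
proof -
  have "linear T" using assms by (simp add: orthogonal_transformation_linear)
  then have [measurable]: "T \<in> borel_measurable borel"
    by (simp add: borel_measurable_continuous_onI linear_continuous_on linear_conv_bounded_linear)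
  let ?f = "\<lambda>x::'a. ennreal (\<Prod>b\<in>Basis. normal_density 0 \<sigma> (x \<bullet> b))"
  have "?f (T x) = ?f x" for x
    using assms by (simp add: isotropic_gaussian_density_eq orthogonal_transformation_norm)
  then show ?thesis
    using density_distr[of ?f borel T lborel]
    by (simp add: distr_lborel_orthogonal_transformation[OF assms] isotropic_gaussian_def)
qed

text \<open>The indicator of the event is absorbed into the factor of coordinate \<open>b\<close>.
  The integral then splits into a product in which every other factor is 1.\<close>

lemma distr_isotropic_gaussian_Basis:
  fixes b :: "'a::euclidean_space"
  assumes "\<sigma> > 0" and b: "b \<in> Basis"
  shows "distr (isotropic_gaussian \<sigma>) borel (\<lambda>x. x \<bullet> b) = density lborel (normal_density 0 \<sigma>)"
proof (rule measure_eqI)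
  fix A assume "A \<in> sets (distr (isotropic_gaussian \<sigma> :: 'a measure) borel (\<lambda>x. x \<bullet> b))"
  then have [measurable]: "A \<in> sets borel" by simp
  let ?f = "\<lambda>c y. normal_density 0 \<sigma> y * (if c = b then indicator A y else 1)"
  have "emeasure (isotropic_gaussian \<sigma>) ((\<lambda>x. x \<bullet> b) -` A) =
      (\<integral>\<^sup>+x. ennreal (\<Prod>c\<in>Basis. normal_density 0 \<sigma> (x \<bullet> c)) * indicator ((\<lambda>x. x \<bullet> b) -` A) x \<partial>lborel)"
    using measurable_sets[of "\<lambda>x. x \<bullet> b" borel borel A]
    by (simp add: isotropic_gaussian_def emeasure_density)
  also have "\<dots> = (\<integral>\<^sup>+x. (\<Prod>c\<in>Basis. ennreal (?f c (x \<bullet> c))) \<partial>lborel)"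
    using b by (intro nn_integral_cong)
      (auto simp: prod.distrib prod_ennreal prod.delta indicator_def)
  also have "\<dots> = (\<Prod>c\<in>Basis. \<integral>\<^sup>+y. ennreal (?f c y) \<partial>lborel)"
    by (rule nn_integral_lborel_prod) auto
  also have "\<dots> = (\<Prod>c\<in>Basis. if c = b then emeasure (density lborel (normal_density 0 \<sigma>)) A else 1)"
  proof (intro prod.cong refl)
    fix c :: 'a
    show "(\<integral>\<^sup>+y. ennreal (?f c y) \<partial>lborel) =
        (if c = b then emeasure (density lborel (normal_density 0 \<sigma>)) A else 1)"
      using assms(1) by (auto simp: emeasure_density ennreal_mult' ennreal_indicator nn_integral_eq_integral)
  qed
  also have "\<dots> = emeasure (density lborel (normal_density 0 \<sigma>)) A"
    using b by (simp add: prod.delta)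
  finally show "emeasure (distr (isotropic_gaussian \<sigma>) borel (\<lambda>x. x \<bullet> b)) A =
      emeasure (density lborel (normal_density 0 \<sigma>)) A"
    by (simp add: emeasure_distr)
qed simp

text \<open>Some orthogonal \<open>T\<close> takes \<open>s\<close> to a basis vector
  \<open>b\<close>. Then \<open>s \<bullet> x = T x \<bullet> b\<close>, and rotation invariance
  reduces the claim to a coordinate.\<close>

lemma distr_isotropic_gaussian_unit:
  fixes s :: "real^'n"
  assumes "\<sigma> > 0" and "norm s = 1"
  shows "distr (isotropic_gaussian \<sigma>) borel (\<lambda>x. s \<bullet> x) = density lborel (normal_density 0 \<sigma>)"
proof -
  obtain b :: "real^'n" where b: "b \<in> Basis" using nonempty_Basis by blast
  then obtain T where T: "orthogonal_transformation T" "T s = b"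
    using orthogonal_transformation_exists[of s b] assms by (metis norm_Basis)
  then have "linear T" by (simp add: orthogonal_transformation_linear)
  then have [measurable]: "T \<in> borel_measurable borel"
    by (simp add: borel_measurable_continuous_onI linear_continuous_on linear_conv_bounded_linear)
  have "s \<bullet> x = T x \<bullet> b" for x
    using T by (metis inner_commute orthogonal_transformation_def)
  then have "distr (isotropic_gaussian \<sigma>) borel (\<lambda>x. s \<bullet> x) =
      distr (distr (isotropic_gaussian \<sigma>) borel T) borel (\<lambda>x. x \<bullet> b)"
    by (simp add: distr_distr comp_def)
  also have "\<dots> = density lborel (normal_density 0 \<sigma>)"
    by (simp add: distr_isotropic_gaussian_orthogonal_transformation[OF T(1)]
        distr_isotropic_gaussian_Basis[OF assms(1) b])
  finally show ?thesis .
qed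

lemma prob_space_isotropic_gaussian:
  assumes "\<sigma> > 0"
  shows "prob_space (isotropic_gaussian \<sigma> :: 'a::euclidean_space measure)"
proof -
  obtain b :: 'a where b: "b \<in> Basis" using nonempty_Basis by blast
  have "prob_space (distr (isotropic_gaussian \<sigma> :: 'a measure) borel (\<lambda>x. x \<bullet> b))"
    by (simp add: distr_isotropic_gaussian_Basis[OF assms b] prob_space_normal_density assms)
  then show ?thesis by (rule prob_space_distrD[rotated]) measurable
qed

section \<open>Positive semidefinite matrices\<close>

lemma psd_symmetric: "psd X \<Longrightarrow> X $ i $ j = X $ j $ i"
  by (simp add: psd_def transpose_def vec_eq_iff)

lemma inner_axis_matrix: "axis i 1 \<bullet> (X *v v) = X $ i \<bullet> v" for X :: "real^'n^'n"
  by (simp add: inner_axis' matrix_vector_mul_component)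

lemma matrix_vector_mult_axis_scale: "X *v (c *\<^sub>R axis i 1) = c *\<^sub>R column i X" for X :: "real^'n^'n"
  by (simp add: matrix_vector_mult_basis matrix_vector_mult_scaleR)

text \<open>This is the quadratic form at \<open>v + c *\<^sub>R axis i 1\<close>, expanded;
  \<open>c\<close> is left free so that it can be optimized later.\<close>

lemma psd_quadratic_form_axis:
  fixes X :: "real^'n^'n"
  assumes "psd X"
  shows "0 \<le> v \<bullet> (X *v v) + 2 * c * (X $ i \<bullet> v) + c\<^sup>2 * X $ i $ i"
proof -
  have col: "column i X = X $ i"
    using psd_symmetric[OF assms] by (simp add: column_def vec_eq_iff)
  have "0 \<le> (v + c *\<^sub>R axis i 1) \<bullet> (X *v (v + c *\<^sub>R axis i 1))"
    using assms by (simp add: psd_def)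
  also have "\<dots> = v \<bullet> (X *v v) + 2 * c * (X $ i \<bullet> v) + c\<^sup>2 * X $ i $ i"
    unfolding matrix_vector_right_distrib matrix_vector_mult_axis_scale inner_add_left inner_add_right
      inner_scaleR_left inner_scaleR_right inner_axis_matrix col
    by (simp add: inner_axis' inner_commute power2_eq_square algebra_simps)
  finally show ?thesis .
qed

lemma psd_diag_nonneg: "psd X \<Longrightarrow> 0 \<le> X $ i $ i" for X :: "real^'n^'n"
  using psd_quadratic_form_axis[of X 0 1 i] by simp

text \<open>Otherwise the form at \<open>axis j 1 + c *\<^sub>R axis i 1\<close> would be affine in
  \<open>c\<close> with nonzero slope, hence negative somewhere.\<close>

lemma psd_zero_diag:
  fixes X :: "real^'n^'n"
  assumes "psd X" and "X $ i $ i = 0"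
  shows "X $ i $ j = 0"
proof (rule ccontr)
  assume nz: "X $ i $ j \<noteq> 0"
  have "0 \<le> X $ j $ j + 2 * c * X $ i $ j" for c
    using psd_quadratic_form_axis[OF assms(1), of "axis j 1" c i] assms(2)
    by (simp add: inner_axis_matrix inner_axis)
  \<comment> \<open>This \<open>c\<close> makes the right-hand side equal to -1.\<close>
  from this[of "- (X $ j $ j + 1) / (2 * X $ i $ j)"] nz show False
    by (simp add: field_simps)
qed

text \<open>Cholesky factorization: each step eliminates one index by a Schur complement.\<close>
lemma psd_eq_sum_rank_one:
  fixes X :: "real^'n^'n"
  assumes "finite I" and "psd X" and "\<And>i. i \<notin> I \<Longrightarrow> X $ i $ i = 0"
  shows "\<exists>W :: 'n \<Rightarrow> real^'n. \<forall>a b. X $ a $ b = (\<Sum>l\<in>I. W l $ a * W l $ b)"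
  using assms
proof (induction I arbitrary: X)
  case empty
  then have "X $ a $ b = 0" for a b by (blast intro: psd_zero_diag)
  then show ?case by simp
next
  case (insert i I)
  define d where "d = X $ i $ i"
  show ?case
  proof (cases "d = 0")
    case True
    with insert.prems have "\<And>j. j \<notin> I \<Longrightarrow> X $ j $ j = 0"
      by (metis d_def insert_iff)
    with insert.IH insert.prems(1) obtain W :: "'n \<Rightarrow> real^'n"
      where W: "\<And>a b. X $ a $ b = (\<Sum>l\<in>I. W l $ a * W l $ b)" by blast
    have "X $ a $ b = (\<Sum>l\<in>insert i I. (W(i := 0)) l $ a * (W(i := 0)) l $ b)" for a b
      using insert.hyps by (auto simp: W intro!: sum.cong)
    then show ?thesis by blast
  next
    case False
    then have d: "d > 0" using psd_diag_nonneg[OF insert.prems(1), of i] by (simp add: d_def)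
    define Y :: "real^'n^'n" where "Y = (\<chi> a b. X $ a $ b - X $ i $ a * X $ i $ b / d)"
    have "psd Y"
      unfolding psd_def
    proof (intro conjI allI)
      show "transpose Y = Y"
        using psd_symmetric[OF insert.prems(1)] by (simp add: transpose_def Y_def vec_eq_iff mult.commute)
      fix v
      have "v \<bullet> (Y *v v) = v \<bullet> (X *v v) - (X $ i \<bullet> v)\<^sup>2 / d"
        unfolding inner_matrix_vector_eq_sum
        by (simp add: Y_def inner_vec_def power2_eq_square sum_product sum_divide_distrib
            sum_subtractf[symmetric] algebra_simps)
      \<comment> \<open>The chosen \<open>c = - (X $ i \<bullet> v) / d\<close> minimizes the form
        of \<open>X\<close> along the direction \<open>axis i 1\<close>; the form of
        \<open>Y\<close> at \<open>v\<close> is this minimum.\<close>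
      also have "\<dots> = v \<bullet> (X *v v) + 2 * (- (X $ i \<bullet> v) / d) * (X $ i \<bullet> v) + (- (X $ i \<bullet> v) / d)\<^sup>2 * X $ i $ i"
        using d by (simp add: d_def[symmetric] field_simps power2_eq_square)
      finally show "0 \<le> v \<bullet> (Y *v v)"
        using psd_quadratic_form_axis[OF insert.prems(1)] by metis
    qed
    moreover have "Y $ j $ j = 0" if "j \<notin> I" for j
    proof (cases "j = i")
      case True
      then show ?thesis using d by (simp add: Y_def d_def)
    next
      case False
      then have "X $ j $ j = 0" using insert.prems(2) that by simp
      moreover from this have "X $ i $ j = 0"
        using psd_zero_diag[OF insert.prems(1)] psd_symmetric[OF insert.prems(1)] by metis
      ultimately show ?thesis by (simp add: Y_def)
    qed
    ultimately obtain W :: "'n \<Rightarrow> real^'n"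
      where W: "\<And>a b. Y $ a $ b = (\<Sum>l\<in>I. W l $ a * W l $ b)"
      using insert.IH by blast
    \<comment> \<open>The new term is exactly the rank-one matrix that was subtracted to form
      \<open>Y\<close>.\<close>
    define V where "V = W(i := (1 / sqrt d) *\<^sub>R X $ i)"
    have "X $ a $ b = (\<Sum>l\<in>insert i I. V l $ a * V l $ b)" for a b
    proof -
      have "(\<Sum>l\<in>I. V l $ a * V l $ b) = Y $ a $ b"
        unfolding W V_def using insert.hyps by (auto intro!: sum.cong)
      then have "(\<Sum>l\<in>insert i I. V l $ a * V l $ b) = V i $ a * V i $ b + Y $ a $ b"
        using insert.hyps by simp
      also have "\<dots> = X $ a $ b"
        using d by (simp add: Y_def V_def)
      finally show ?thesis by simp
    qed
    then show ?thesis by blast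
  qed
qed

lemma psd_gram:
  fixes X :: "real^'n^'n"
  assumes "psd X"
  obtains s :: "'n \<Rightarrow> real^'n" where "\<And>a b. X $ a $ b = s a \<bullet> s b"
proof -
  obtain W :: "'n \<Rightarrow> real^'n" where "\<And>a b. X $ a $ b = (\<Sum>l\<in>UNIV. W l $ a * W l $ b)"
    using psd_eq_sum_rank_one[of UNIV X] assms by auto
  then show thesis by (intro that[of "\<lambda>a. \<chi> l. W l $ a"]) (simp add: inner_vec_def)
qed

section \<open>Pairing with \<open>M\<close> and feasible points of the two programs\<close>

lemma mat_inner_add_right: "mat_inner M (A + B) = mat_inner M A + mat_inner M B"
  and mat_inner_scaleR_right: "mat_inner M (c *\<^sub>R A) = c * mat_inner M A"
  and mat_inner_uminus_left: "mat_inner (- M) A = - mat_inner M A"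
  by (simp_all add: mat_inner_eq_sum sum.distrib sum_distrib_left sum_negf algebra_simps)

lemma mat_inner_le_SDP: "X \<in> elliptope \<Longrightarrow> mat_inner M X \<le> SDP M"
  using SDP_attained[of M] by auto

lemma mat_inner_le_OPT: "k \<ge> 1 \<Longrightarrow> X \<in> elliptope \<Longrightarrow> rank X \<le> k \<Longrightarrow> mat_inner M X \<le> OPT k M"
  using OPT_attained[of k M] by auto

text \<open>For \<open>c > 0\<close> the rescaled matrix \<open>(1 / c) *\<^sub>R Z\<close> is
  feasible; \<open>c = 0\<close> forces \<open>Z = 0\<close>.\<close>

lemma mat_inner_psd_le_SDP:
  fixes Z :: "real^'n^'n"
  assumes Z: "psd Z" and diag: "\<And>i. Z $ i $ i = c"
  shows "mat_inner M Z \<le> c * SDP M"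
proof (cases "c = 0")
  case True
  then have "Z = 0" using psd_zero_diag[OF Z] diag by (simp add: vec_eq_iff)
  then show ?thesis using True by (simp add: mat_inner_eq_sum)
next
  case False
  then have c: "c > 0" using psd_diag_nonneg[OF Z] diag by (metis order_le_less)
  have "transpose ((1 / c) *\<^sub>R Z) = (1 / c) *\<^sub>R Z"
    using psd_symmetric[OF Z] by (simp add: transpose_def vec_eq_iff)
  moreover have "v \<bullet> ((1 / c) *\<^sub>R Z *v v) = (1 / c) * (v \<bullet> (Z *v v))" for v
    unfolding inner_matrix_vector_eq_sum by (simp add: sum_distrib_left sum_divide_distrib)
  ultimately have "(1 / c) *\<^sub>R Z \<in> elliptope"
    using Z c diag by (auto simp: elliptope_def psd_def)
  from mat_inner_le_SDP[OF this, of M] show ?thesis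
    using c by (simp add: mat_inner_scaleR_right field_simps)
qed

text \<open>The quadratic form is a sum of squares, and every row lies in the span of the
  \<open>k\<close> vectors \<open>\<chi> j. u j t\<close>.\<close>

lemma gram_matrix_elliptope_rank:
  fixes u :: "'n::finite \<Rightarrow> nat \<Rightarrow> real"
  assumes "\<And>i. (\<Sum>t<k. u i t * u i t) = 1"
  defines "X \<equiv> (\<chi> i j. \<Sum>t<k. u i t * u j t) :: real^'n^'n"
  shows "X \<in> elliptope" and "rank X \<le> k"
proof -
  have "v \<bullet> (X *v v) = (\<Sum>t<k. (\<Sum>i\<in>UNIV. v $ i * u i t)\<^sup>2)" for v
  proof -
    have "v \<bullet> (X *v v) = (\<Sum>i\<in>UNIV. \<Sum>j\<in>UNIV. \<Sum>t<k. (v $ i * u i t) * (v $ j * u j t))"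
      unfolding inner_matrix_vector_eq_sum X_def
      by (simp add: sum_distrib_left sum_distrib_right mult_ac)
    also have "\<dots> = (\<Sum>i\<in>UNIV. \<Sum>t<k. \<Sum>j\<in>UNIV. (v $ i * u i t) * (v $ j * u j t))"
      by (intro sum.cong refl sum.swap)
    also have "\<dots> = (\<Sum>t<k. \<Sum>i\<in>UNIV. \<Sum>j\<in>UNIV. (v $ i * u i t) * (v $ j * u j t))"
      by (rule sum.swap)
    finally show ?thesis by (simp add: power2_eq_square sum_product)
  qed
  then have "0 \<le> v \<bullet> (X *v v)" for v by (simp add: sum_nonneg)
  then show "X \<in> elliptope"
    using assms(1) by (simp add: elliptope_def psd_def X_def transpose_def mult.commute)
  let ?B = "(\<lambda>t. (\<chi> j. u j t) :: real^'n) ` {..<k}"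
  have "X $ i = (\<Sum>t<k. u i t *\<^sub>R (\<chi> j. u j t))" for i
    by (simp add: X_def vec_eq_iff)
  then have "X $ i \<in> span ?B" for i
    by (simp only:) (intro span_sum span_scale span_base imageI)
  then have "rows X \<subseteq> span ?B" by (auto simp: rows_def row_def)
  then have "dim (rows X) \<le> card ?B" by (intro dim_le_card) auto
  also have "\<dots> \<le> k" using card_image_le[of "{..<k}"] by force
  finally show "rank X \<le> k" by (simp add: row_rank_def)
qed

section \<open>Gaussian rounding\<close>

text \<open>A sample \<open>\<omega>\<close> lists the \<open>k\<close> columns of the matrix \<open>G\<close>, so \<open>s \<bullet> \<omega> t\<close> is entry \<open>t\<close> of \<open>G\<^sup>T s\<close>.\<close>
definition gaussian_matrix :: "nat \<Rightarrow> (nat \<Rightarrow> real^'n) measure" where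
  "gaussian_matrix k = (\<Pi>\<^sub>M t\<in>{..<k}. isotropic_gaussian (1 / sqrt (real k)))"

abbreviation proj_norm :: "nat \<Rightarrow> real^'n \<Rightarrow> (nat \<Rightarrow> real^'n) \<Rightarrow> real" where
  "proj_norm k s \<omega> \<equiv> L2_set (\<lambda>t. s \<bullet> \<omega> t) {..<k}"

lemma prob_space_gaussian_matrix: "k \<ge> 1 \<Longrightarrow> prob_space (gaussian_matrix k)"
  unfolding gaussian_matrix_def by (intro prob_space_PiM prob_space_isotropic_gaussian) simp

lemma measurable_proj [measurable]:
  "t < k \<Longrightarrow> (\<lambda>\<omega>. s \<bullet> \<omega> t) \<in> borel_measurable (gaussian_matrix k)"
  unfolding gaussian_matrix_def
  by (rule measurable_compose[OF measurable_component_singleton]) auto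

lemma measurable_proj_norm [measurable]: "proj_norm k s \<in> borel_measurable (gaussian_matrix k)"
  unfolding L2_set_def by measurable

lemma proj_norm_squared: "(proj_norm k s \<omega>)\<^sup>2 = (\<Sum>t<k. (s \<bullet> \<omega> t)\<^sup>2)"
  by (simp add: L2_set_def sum_nonneg)

lemma distr_proj:
  fixes s :: "real^'n"
  assumes "k \<ge> 1" "t < k" "norm s = 1"
  shows "distr (gaussian_matrix k) borel (\<lambda>\<omega>. s \<bullet> \<omega> t) = density lborel (normal_density 0 (1 / sqrt (real k)))"
proof -
  let ?G = "isotropic_gaussian (1 / sqrt (real k)) :: (real^'n) measure"
  have [measurable]: "(\<lambda>\<omega>. \<omega> t) \<in> gaussian_matrix k \<rightarrow>\<^sub>M ?G"
    using assms(2) by (simp add: gaussian_matrix_def)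
  have "distr (gaussian_matrix k) borel (\<lambda>\<omega>. s \<bullet> \<omega> t) =
      distr (distr (gaussian_matrix k) ?G (\<lambda>\<omega>. \<omega> t)) borel (\<lambda>x. s \<bullet> x)"
    by (simp add: distr_distr comp_def)
  also have "distr (gaussian_matrix k) ?G (\<lambda>\<omega>. \<omega> t) = ?G"
    unfolding gaussian_matrix_def using assms
    by (intro distr_PiM_component prob_space_isotropic_gaussian) auto
  finally show ?thesis
    using assms by (simp add: distr_isotropic_gaussian_unit)
qed

lemma has_bochner_integral_proj_squared:
  fixes s :: "real^'n"
  assumes "k \<ge> 1" "t < k" "norm s = 1"
  shows "has_bochner_integral (gaussian_matrix k) (\<lambda>\<omega>. (s \<bullet> \<omega> t)\<^sup>2) (1 / real k)"
proof -
  have \<sigma>: "0 < 1 / sqrt (real k)" using assms(1) by simp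
  have [measurable]: "(\<lambda>\<omega>. s \<bullet> \<omega> t) \<in> borel_measurable (gaussian_matrix k)"
    using assms(2) by measurable
  have "has_bochner_integral lborel (\<lambda>x. normal_density 0 (1 / sqrt (real k)) x *\<^sub>R x\<^sup>2) (1 / real k)"
    using normal_moment_even[OF \<sigma>, of 0 1] assms(1) by (simp add: fact_numeral power_divide)
  then have "has_bochner_integral (density lborel (normal_density 0 (1 / sqrt (real k)))) (\<lambda>x. x\<^sup>2) (1 / real k)"
    by (subst has_bochner_integral_density) auto
  then have "has_bochner_integral (distr (gaussian_matrix k) borel (\<lambda>\<omega>. s \<bullet> \<omega> t)) (\<lambda>x. x\<^sup>2) (1 / real k)"
    by (simp add: distr_proj[OF assms])
  then show ?thesis
    by (simp add: has_bochner_integral_iff integrable_distr_eq integral_distr)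
qed

text \<open>A vanishing norm forces the coordinate with index 0 to vanish, a null event because its
  law has a density.\<close>

lemma AE_proj_norm_neq_0:
  fixes s :: "real^'n"
  assumes "k \<ge> 1" "norm s = 1"
  shows "AE \<omega> in gaussian_matrix k. proj_norm k s \<omega> \<noteq> 0"
proof -
  have [measurable]: "(\<lambda>\<omega>. s \<bullet> \<omega> 0) \<in> borel_measurable (gaussian_matrix k)"
    using assms(1) by (intro measurable_proj) simp
  have "AE x in distr (gaussian_matrix k) borel (\<lambda>\<omega>. s \<bullet> \<omega> 0). x \<noteq> 0"
    using AE_lborel_singleton[of "0::real"] assms by (subst distr_proj) (auto simp: AE_density)
  then have "AE \<omega> in gaussian_matrix k. s \<bullet> \<omega> 0 \<noteq> 0"
    by (rule AE_distrD[rotated]) fact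
  then show ?thesis
    using assms(1) by (auto simp: L2_set_eq_0_iff elim!: eventually_mono)
qed

text \<open>The \<open>k\<close> coordinates contribute variance \<open>1 / k\<close> each; the
  normalization of the Gaussian is chosen for this.\<close>

lemma integral_proj_norm_squared:
  fixes s :: "real^'n"
  assumes "k \<ge> 1" "norm s = 1"
  shows "integrable (gaussian_matrix k) (\<lambda>\<omega>. (proj_norm k s \<omega>)\<^sup>2)"
    and "(\<integral>\<omega>. (proj_norm k s \<omega>)\<^sup>2 \<partial>gaussian_matrix k) = 1"
proof -
  have "has_bochner_integral (gaussian_matrix k) (\<lambda>\<omega>. \<Sum>t<k. (s \<bullet> \<omega> t)\<^sup>2) (\<Sum>t<k. 1 / real k)"
    using assms by (intro has_bochner_integral_sum has_bochner_integral_proj_squared) auto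
  then have *: "has_bochner_integral (gaussian_matrix k) (\<lambda>\<omega>. (proj_norm k s \<omega>)\<^sup>2) 1"
    using assms(1) by (simp add: proj_norm_squared)
  show "integrable (gaussian_matrix k) (\<lambda>\<omega>. (proj_norm k s \<omega>)\<^sup>2)"
    using * by (rule integrable.intros)
  show "(\<integral>\<omega>. (proj_norm k s \<omega>)\<^sup>2 \<partial>gaussian_matrix k) = 1"
    using * by (rule has_bochner_integral_integral_eq)
qed

lemma integrable_proj_norm:
  fixes s :: "real^'n"
  assumes "k \<ge> 1" "norm s = 1"
  shows "integrable (gaussian_matrix k) (proj_norm k s)"
proof -
  interpret prob_space "gaussian_matrix k" using assms(1) by (rule prob_space_gaussian_matrix)
  show ?thesis
    by (rule square_integrable_imp_integrable) (simp_all add: integral_proj_norm_squared[OF assms])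
qed

text \<open>The coordinates \<open>s \<bullet> \<omega> t\<close> come from different independent
  columns, and each is normal because \<open>s\<close> is a unit vector. This ties the random matrix
  to the law that defines \<open>alpha\<close>.\<close>

lemma distr_gaussian_matrix_proj:
  fixes s :: "real^'n"
  assumes "k \<ge> 1" "norm s = 1"
  shows "distr (gaussian_matrix k) (gaussian_vec k) (compose {..<k} (\<lambda>x. s \<bullet> x)) = gaussian_vec k"
proof -
  let ?N = "density lborel (\<lambda>x. ennreal (normal_density 0 (1 / sqrt (real k)) x))"
  have "distr (isotropic_gaussian (1 / sqrt (real k))) ?N (\<lambda>x. s \<bullet> x) =
      distr (isotropic_gaussian (1 / sqrt (real k))) borel (\<lambda>x. s \<bullet> x)"
    by (rule distr_cong) simp_all
  also have "\<dots> = ?N" using assms by (simp add: distr_isotropic_gaussian_unit)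
  finally have eq: "distr (isotropic_gaussian (1 / sqrt (real k))) ?N (\<lambda>x. s \<bullet> x) = ?N" .
  show ?thesis
    unfolding gaussian_matrix_def gaussian_vec_def using assms(1)
    by (subst distr_PiM_finite_prob_space')
      (auto simp: eq intro!: prob_space_isotropic_gaussian prob_space_normal_density)
qed

lemma integral_proj_norm:
  fixes s :: "real^'n"
  assumes "k \<ge> 1" "norm s = 1"
  shows "(\<integral>\<omega>. proj_norm k s \<omega> \<partial>gaussian_matrix k) = sqrt (alpha k)"
proof -
  have [measurable]: "compose {..<k} (\<lambda>x. s \<bullet> x) \<in> gaussian_matrix k \<rightarrow>\<^sub>M gaussian_vec k"
    unfolding gaussian_vec_def compose_def
    by (intro measurable_restrict) (auto simp: measurable_proj)
  have [measurable]: "(\<lambda>g. L2_set g {..<k}) \<in> borel_measurable (gaussian_vec k)"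
    unfolding gaussian_vec_def L2_set_def by measurable
  have "(\<integral>g. L2_set g {..<k} \<partial>gaussian_vec k) =
      (\<integral>g. L2_set g {..<k} \<partial>distr (gaussian_matrix k) (gaussian_vec k) (compose {..<k} (\<lambda>x. s \<bullet> x)))"
    by (simp add: distr_gaussian_matrix_proj[OF assms])
  also have "\<dots> = (\<integral>\<omega>. L2_set (compose {..<k} (\<lambda>x. s \<bullet> x) \<omega>) {..<k} \<partial>gaussian_matrix k)"
    by (rule integral_distr) measurable
  also have "\<dots> = (\<integral>\<omega>. proj_norm k s \<omega> \<partial>gaussian_matrix k)"
    by (intro Bochner_Integration.integral_cong refl L2_set_cong) (simp add: compose_def)
  finally have "(\<integral>g. L2_set g {..<k} \<partial>gaussian_vec k) = (\<integral>\<omega>. proj_norm k s \<omega> \<partial>gaussian_matrix k)" .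
  moreover have "0 \<le> (\<integral>\<omega>. proj_norm k s \<omega> \<partial>gaussian_matrix k)"
    by (intro Bochner_Integration.integral_nonneg) simp
  ultimately show ?thesis by (simp add: alpha_def)
qed

text \<open>A nonnegative function with zero mean vanishes almost everywhere, but the norm is almost
  surely nonzero. Dimension one suffices since \<open>alpha\<close> depends on \<open>k\<close>
  only.\<close>

lemma alpha_pos:
  assumes "k \<ge> 1"
  shows "alpha k > 0"
proof -
  obtain s :: "real^1" where s: "norm s = 1" using vector_choose_size[of 1] by auto
  interpret prob_space "gaussian_matrix k :: (nat \<Rightarrow> real^1) measure"
    using assms by (rule prob_space_gaussian_matrix)
  have "(\<integral>\<omega>. proj_norm k s \<omega> \<partial>gaussian_matrix k) \<noteq> 0"
  proof
    assume "(\<integral>\<omega>. proj_norm k s \<omega> \<partial>gaussian_matrix k) = 0"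
    then have "AE \<omega> in gaussian_matrix k. proj_norm k s \<omega> = 0"
      using integrable_proj_norm[OF assms s] by (subst (asm) integral_nonneg_eq_0_iff_AE) auto
    with AE_proj_norm_neq_0[OF assms s] have "AE \<omega> in gaussian_matrix k :: (nat \<Rightarrow> real^1) measure. False"
      by eventually_elim simp
    then show False by simp
  qed
  then show ?thesis
    using integral_proj_norm[OF assms s] by (simp add: alpha_def)
qed

lemma distr_gaussian_matrix_orthogonal_transformation:
  fixes T :: "real^'n \<Rightarrow> real^'n"
  assumes "k \<ge> 1" and T: "orthogonal_transformation T"
  shows "distr (gaussian_matrix k) (gaussian_matrix k) (compose {..<k} T) = gaussian_matrix k"
proof -
  let ?G = "isotropic_gaussian (1 / sqrt (real k)) :: (real^'n) measure"
  have "linear T" using T by (simp add: orthogonal_transformation_linear)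
  then have [measurable]: "T \<in> borel_measurable borel"
    by (simp add: borel_measurable_continuous_onI linear_continuous_on linear_conv_bounded_linear)
  have "distr ?G ?G T = distr ?G borel T" by (rule distr_cong) simp_all
  also have "\<dots> = ?G" by (rule distr_isotropic_gaussian_orthogonal_transformation[OF T])
  finally have eq: "distr ?G ?G T = ?G" .
  show ?thesis
    unfolding gaussian_matrix_def using assms(1)
    by (subst distr_PiM_finite_prob_space') (auto simp: eq intro!: prob_space_isotropic_gaussian)
qed

text \<open>The reflection negating \<open>w\<close> fixes \<open>s\<close>, so it preserves the law and negates the integrand.\<close>
lemma integral_proj_orthogonal_eq_0:
  fixes s w :: "real^'n"
  assumes "k \<ge> 1" "s \<bullet> w = 0" and [measurable]: "q \<in> borel_measurable borel"
  shows "(\<integral>\<omega>. q (proj_norm k s \<omega>) * (\<Sum>t<k. (s \<bullet> \<omega> t) * (w \<bullet> \<omega> t)) \<partial>gaussian_matrix k) = (0::real)"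
proof -
  define T where "T x = x - (2 * (w \<bullet> x) / (w \<bullet> w)) *\<^sub>R w" for x
  have "linear T"
    by (rule linearI) (simp_all add: T_def algebra_simps inner_add_right add_divide_distrib scaleR_add_left)
  moreover have "T x \<bullet> T y = x \<bullet> y" for x y
    by (cases "w = 0") (auto simp: T_def inner_diff_left inner_diff_right inner_commute field_simps)
  ultimately have T: "orthogonal_transformation T" by (simp add: orthogonal_transformation_def)
  have [measurable]: "T \<in> borel_measurable borel"
    using \<open>linear T\<close> by (simp add: borel_measurable_continuous_onI linear_continuous_on linear_conv_bounded_linear)
  have s: "s \<bullet> T x = s \<bullet> x" for x using assms(2) by (simp add: T_def inner_diff_right)
  have w: "w \<bullet> T x = - (w \<bullet> x)" for x by (cases "w = 0") (auto simp: T_def inner_diff_right)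
  have [measurable]: "compose {..<k} T \<in> gaussian_matrix k \<rightarrow>\<^sub>M gaussian_matrix k"
    unfolding gaussian_matrix_def compose_def by measurable
  let ?f = "\<lambda>\<omega>. q (proj_norm k s \<omega>) * (\<Sum>t<k. (s \<bullet> \<omega> t) * (w \<bullet> \<omega> t))"
  have "(\<integral>\<omega>. ?f \<omega> \<partial>gaussian_matrix k) = (\<integral>\<omega>. ?f \<omega> \<partial>distr (gaussian_matrix k) (gaussian_matrix k) (compose {..<k} T))"
    by (simp add: distr_gaussian_matrix_orthogonal_transformation[OF assms(1) T])
  also have "\<dots> = (\<integral>\<omega>. ?f (compose {..<k} T \<omega>) \<partial>gaussian_matrix k)"
    by (rule integral_distr) measurable
  also have "\<dots> = (\<integral>\<omega>. - ?f \<omega> \<partial>gaussian_matrix k)"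
  proof (rule Bochner_Integration.integral_cong[OF refl])
    fix \<omega>
    have "proj_norm k s (compose {..<k} T \<omega>) = proj_norm k s \<omega>"
      by (rule L2_set_cong) (simp_all add: compose_def s)
    then show "?f (compose {..<k} T \<omega>) = - ?f \<omega>"
      by (simp add: compose_def s w sum_negf)
  qed
  finally show ?thesis by simp
qed

text \<open>On the null event \<open>G\<^sup>T s = 0\<close> the rounded vector is \<open>0\<close>, not a unit vector.\<close>
definition rounded :: "nat \<Rightarrow> real^'n \<Rightarrow> (nat \<Rightarrow> real^'n) \<Rightarrow> nat \<Rightarrow> real" where
  "rounded k s \<omega> t = inverse (proj_norm k s \<omega>) * (s \<bullet> \<omega> t)"

lemma measurable_rounded [measurable]:
  "t < k \<Longrightarrow> (\<lambda>\<omega>. rounded k s \<omega> t) \<in> borel_measurable (gaussian_matrix k)"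
  unfolding rounded_def by measurable

lemma abs_le_L2_set: "finite A \<Longrightarrow> t \<in> A \<Longrightarrow> \<bar>f t\<bar> \<le> L2_set f A"
  using member_le_L2_set[of A t "\<lambda>i. \<bar>f i\<bar>"] by (simp add: L2_set_def)

lemma abs_rounded_le: "t < k \<Longrightarrow> \<bar>rounded k s \<omega> t\<bar> \<le> 1"
  using abs_le_L2_set[of "{..<k}" t "\<lambda>t. s \<bullet> \<omega> t"]
  by (cases "proj_norm k s \<omega> = 0") (auto simp: rounded_def abs_mult field_simps)

lemma sum_rounded_squared:
  assumes "proj_norm k s \<omega> \<noteq> 0"
  shows "(\<Sum>t<k. rounded k s \<omega> t * rounded k s \<omega> t) = 1"
proof -
  have "(\<Sum>t<k. rounded k s \<omega> t * rounded k s \<omega> t) = (inverse (proj_norm k s \<omega>))\<^sup>2 * (proj_norm k s \<omega>)\<^sup>2"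
    unfolding proj_norm_squared by (simp add: rounded_def sum_distrib_left power2_eq_square mult_ac)
  then show ?thesis using assms by (simp flip: power_mult_distrib)
qed

section \<open>Integrability and mixed moments of projected and rounded vectors\<close>

lemma integrable_proj_mult:
  fixes s r :: "real^'n"
  assumes "k \<ge> 1" "t < k" "norm s = 1" "norm r = 1"
  shows "integrable (gaussian_matrix k) (\<lambda>\<omega>. (s \<bullet> \<omega> t) * (r \<bullet> \<omega> t))"
proof (rule Bochner_Integration.integrable_bound)
  show "integrable (gaussian_matrix k) (\<lambda>\<omega>. (s \<bullet> \<omega> t)\<^sup>2 + (r \<bullet> \<omega> t)\<^sup>2)"
    using assms by (intro Bochner_Integration.integrable_add integrable.intros[OF has_bochner_integral_proj_squared])
  show "(\<lambda>\<omega>. (s \<bullet> \<omega> t) * (r \<bullet> \<omega> t)) \<in> borel_measurable (gaussian_matrix k)"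
    using assms(2) by measurable
  have "\<bar>a * b\<bar> \<le> a\<^sup>2 + b\<^sup>2" for a b :: real
    using sum_squares_bound[of "\<bar>a\<bar>" "\<bar>b\<bar>"] abs_ge_zero[of "a * b"]
    unfolding abs_mult power2_abs by linarith
  then show "AE \<omega> in gaussian_matrix k. norm ((s \<bullet> \<omega> t) * (r \<bullet> \<omega> t)) \<le> norm ((s \<bullet> \<omega> t)\<^sup>2 + (r \<bullet> \<omega> t)\<^sup>2)"
    by simp
qed

text \<open>Rounded coordinates are bounded by 1, so the integrable function
  \<open>proj_norm k r\<close> dominates the product.\<close>

lemma integrable_rounded_mult_proj:
  fixes s r :: "real^'n"
  assumes "k \<ge> 1" "t < k" "norm r = 1"
  shows "integrable (gaussian_matrix k) (\<lambda>\<omega>. rounded k s \<omega> t * (r \<bullet> \<omega> t))"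
proof (rule Bochner_Integration.integrable_bound)
  show "integrable (gaussian_matrix k) (proj_norm k r)"
    using assms by (intro integrable_proj_norm)
  show "(\<lambda>\<omega>. rounded k s \<omega> t * (r \<bullet> \<omega> t)) \<in> borel_measurable (gaussian_matrix k)"
    using assms(2) by measurable
  have "\<bar>rounded k s \<omega> t * (r \<bullet> \<omega> t)\<bar> \<le> 1 * proj_norm k r \<omega>" for \<omega>
    unfolding abs_mult using assms(2)
    by (intro mult_mono abs_rounded_le abs_le_L2_set) auto
  then show "AE \<omega> in gaussian_matrix k. norm (rounded k s \<omega> t * (r \<bullet> \<omega> t)) \<le> norm (proj_norm k r \<omega>)"
    by simp
qed

lemma integrable_rounded_mult_rounded:
  fixes s r :: "real^'n"
  assumes "k \<ge> 1" "t < k"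
  shows "integrable (gaussian_matrix k) (\<lambda>\<omega>. rounded k s \<omega> t * rounded k r \<omega> t)"
proof -
  interpret prob_space "gaussian_matrix k :: (nat \<Rightarrow> real^'n) measure"
    using assms(1) by (rule prob_space_gaussian_matrix)
  have "\<bar>rounded k s \<omega> t * rounded k r \<omega> t\<bar> \<le> 1 * 1" for \<omega>
    unfolding abs_mult using assms(2) by (intro mult_mono abs_rounded_le) auto
  then show ?thesis using assms(2) by (intro integrable_const_bound[of _ 1]) auto
qed

lemma inner_diff_scaleR_orthogonal:
  assumes "norm s = 1" shows "s \<bullet> (r - (s \<bullet> r) *\<^sub>R s) = 0"
  using assms by (simp add: inner_diff_right norm_eq_1)

text \<open>Split \<open>r\<close> into \<open>(s \<bullet> r) *\<^sub>R s\<close> and a part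
  \<open>w\<close> orthogonal to \<open>s\<close>. The part \<open>w\<close> integrates to 0 by
  reflection, leaving the factor \<open>s \<bullet> r\<close>. The weights \<open>1\<close> and
  \<open>inverse\<close> give the two moments needed below.\<close>

lemma integral_weighted_proj_mult:
  fixes s r :: "real^'n"
  assumes "k \<ge> 1" "norm s = 1" and [measurable]: "q \<in> borel_measurable borel"
    and int: "integrable (gaussian_matrix k) (\<lambda>\<omega>. q (proj_norm k s \<omega>) * (\<Sum>t<k. (s \<bullet> \<omega> t) * (r \<bullet> \<omega> t)))"
    and int2: "integrable (gaussian_matrix k) (\<lambda>\<omega>. q (proj_norm k s \<omega>) * (proj_norm k s \<omega>)\<^sup>2)"
  shows "(\<integral>\<omega>. q (proj_norm k s \<omega>) * (\<Sum>t<k. (s \<bullet> \<omega> t) * (r \<bullet> \<omega> t)) \<partial>gaussian_matrix k) =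
    (s \<bullet> r) * (\<integral>\<omega>. q (proj_norm k s \<omega>) * (proj_norm k s \<omega>)\<^sup>2 \<partial>gaussian_matrix k)"
proof -
  define w where "w = r - (s \<bullet> r) *\<^sub>R s"
  have "q (proj_norm k s \<omega>) * (\<Sum>t<k. (s \<bullet> \<omega> t) * (w \<bullet> \<omega> t)) =
      q (proj_norm k s \<omega>) * (\<Sum>t<k. (s \<bullet> \<omega> t) * (r \<bullet> \<omega> t)) -
      (s \<bullet> r) * (q (proj_norm k s \<omega>) * (proj_norm k s \<omega>)\<^sup>2)" for \<omega>
    unfolding proj_norm_squared
    by (simp add: w_def inner_diff_left power2_eq_square sum_distrib_left sum_subtractf[symmetric] algebra_simps)
  with integral_proj_orthogonal_eq_0[OF assms(1) inner_diff_scaleR_orthogonal[OF assms(2), of r] assms(3)]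
  have "(\<integral>\<omega>. q (proj_norm k s \<omega>) * (\<Sum>t<k. (s \<bullet> \<omega> t) * (r \<bullet> \<omega> t)) -
      (s \<bullet> r) * (q (proj_norm k s \<omega>) * (proj_norm k s \<omega>)\<^sup>2) \<partial>gaussian_matrix k) = 0"
    by (simp add: w_def)
  then show ?thesis using int int2 by simp
qed

lemma integral_proj_mult:
  fixes s r :: "real^'n"
  assumes "k \<ge> 1" "norm s = 1" "norm r = 1"
  shows "(\<integral>\<omega>. (\<Sum>t<k. (s \<bullet> \<omega> t) * (r \<bullet> \<omega> t)) \<partial>gaussian_matrix k) = s \<bullet> r"
proof -
  have "integrable (gaussian_matrix k) (\<lambda>\<omega>. \<Sum>t<k. (s \<bullet> \<omega> t) * (r \<bullet> \<omega> t))"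
    using assms by (intro Bochner_Integration.integrable_sum integrable_proj_mult) auto
  then show ?thesis
    using integral_weighted_proj_mult[of k s "\<lambda>_. 1" r] integral_proj_norm_squared[OF assms(1,2)] assms
    by simp
qed

lemma integral_rounded_mult_proj:
  fixes s r :: "real^'n"
  assumes "k \<ge> 1" "norm s = 1" "norm r = 1"
  shows "(\<integral>\<omega>. (\<Sum>t<k. rounded k s \<omega> t * (r \<bullet> \<omega> t)) \<partial>gaussian_matrix k) = sqrt (alpha k) * (s \<bullet> r)"
proof -
  have eq: "(\<Sum>t<k. rounded k s \<omega> t * (r \<bullet> \<omega> t)) =
      inverse (proj_norm k s \<omega>) * (\<Sum>t<k. (s \<bullet> \<omega> t) * (r \<bullet> \<omega> t))" for \<omega>
    by (simp add: rounded_def sum_distrib_left mult.assoc)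
  \<comment> \<open>At 0 this rests on \<open>inverse 0 = 0\<close>. It reduces the weighted second
    moment to the mean norm.\<close>
  have eq2: "inverse x * x\<^sup>2 = x" for x :: real
    by (cases "x = 0") (simp_all add: power2_eq_square)
  have "integrable (gaussian_matrix k) (\<lambda>\<omega>. \<Sum>t<k. rounded k s \<omega> t * (r \<bullet> \<omega> t))"
    using assms by (intro Bochner_Integration.integrable_sum integrable_rounded_mult_proj) auto
  then show ?thesis
    using integral_weighted_proj_mult[of k s inverse r] integrable_proj_norm[OF assms(1,2)]
      integral_proj_norm[OF assms(1,2)] assms
    by (simp add: eq eq2)
qed

section \<open>The expected Gram matrix of the rounded vectors and the resulting bounds\<close>

text \<open>Almost every sample yields a Gram matrix feasible for \<open>OPT k M\<close>, so the
  bound passes to the mean \<open>A\<close>, although \<open>A\<close> itself may have rank above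
  \<open>k\<close>.\<close>

lemma rounded_covariance:
  fixes s :: "'n::finite \<Rightarrow> real^'n"
  assumes k: "k \<ge> 1" and unit: "\<And>i. norm (s i) = 1"
  defines "A \<equiv> (\<chi> i j. \<integral>\<omega>. (\<Sum>t<k. rounded k (s i) \<omega> t * rounded k (s j) \<omega> t) \<partial>gaussian_matrix k) :: real^'n^'n"
    and "X \<equiv> (\<chi> i j. s i \<bullet> s j) :: real^'n^'n"
  shows "A $ i $ i = 1" and "mat_inner M A \<le> OPT k M" and "psd (A - alpha k *\<^sub>R X)"
proof -
  let ?P = "gaussian_matrix k :: (nat \<Rightarrow> real^'n) measure"
  interpret prob_space ?P using k by (rule prob_space_gaussian_matrix)
  let ?u = "\<lambda>i \<omega> t. rounded k (s i) \<omega> t"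
  let ?x = "\<lambda>i (\<omega> :: nat \<Rightarrow> real^'n) t. s i \<bullet> \<omega> t"
  have "AE \<omega> in ?P. \<forall>i\<in>UNIV. proj_norm k (s i) \<omega> \<noteq> 0"
    using AE_proj_norm_neq_0[OF k unit] by (intro AE_finite_allI) auto
  then have nz: "AE \<omega> in ?P. \<forall>i. proj_norm k (s i) \<omega> \<noteq> 0" by simp
  have intA [simp]: "integrable ?P (\<lambda>\<omega>. \<Sum>t<k. ?u i \<omega> t * ?u j \<omega> t)" for i j
    using k by (intro Bochner_Integration.integrable_sum integrable_rounded_mult_rounded) auto

  have "(\<integral>\<omega>. (\<Sum>t<k. ?u i \<omega> t * ?u i \<omega> t) \<partial>?P) = (\<integral>\<omega>. 1 \<partial>?P)"
    using nz by (intro integral_cong_AE) (auto elim!: eventually_mono simp: sum_rounded_squared)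
  then show "A $ i $ i = 1" by (simp add: A_def prob_space)

  have "mat_inner M A = (\<integral>\<omega>. (\<Sum>i\<in>UNIV. \<Sum>j\<in>UNIV. M $ i $ j * (\<Sum>t<k. ?u i \<omega> t * ?u j \<omega> t)) \<partial>?P)"
    by (simp add: mat_inner_eq_sum A_def)
  also have "\<dots> \<le> (\<integral>\<omega>. OPT k M \<partial>?P)"
  proof (rule integral_mono_AE)
    show "AE \<omega> in ?P. (\<Sum>i\<in>UNIV. \<Sum>j\<in>UNIV. M $ i $ j * (\<Sum>t<k. ?u i \<omega> t * ?u j \<omega> t)) \<le> OPT k M"
      using nz
    proof eventually_elim
      case (elim \<omega>)
      then have "(\<Sum>t<k. ?u i \<omega> t * ?u i \<omega> t) = 1" for i by (simp add: sum_rounded_squared)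
      from mat_inner_le_OPT[OF k gram_matrix_elliptope_rank[where k = k and u = "\<lambda>i. ?u i \<omega>", OF this], of M]
      show ?case by (simp add: mat_inner_eq_sum)
    qed
  qed (intro Bochner_Integration.integrable_sum Bochner_Integration.integrable_mult_right,
      simp_all add: integrable_rounded_mult_rounded[OF k])
  finally show "mat_inner M A \<le> OPT k M" by (simp add: prob_space)

  \<comment> \<open>With this factor the two cross terms contribute \<open>- 2 * alpha k\<close>
    times \<open>X\<close> and the last term \<open>alpha k\<close> times \<open>X\<close>. This
    choice also minimizes the mean squared length of the difference \<open>?d\<close>.\<close>
  define b where "b = sqrt (alpha k)"
  have b2: "b * b = alpha k" using alpha_pos[OF k] by (simp add: b_def)
  let ?d = "\<lambda>i \<omega> t. ?u i \<omega> t - b * ?x i \<omega> t"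
  have expand: "?d i \<omega> t * ?d j \<omega> t =
      ?u i \<omega> t * ?u j \<omega> t - b * (?u i \<omega> t * ?x j \<omega> t) - b * (?u j \<omega> t * ?x i \<omega> t) + alpha k * (?x i \<omega> t * ?x j \<omega> t)"
    for i j \<omega> t by (simp add: b2[symmetric] algebra_simps)
  have int1: "integrable ?P (\<lambda>\<omega>. \<Sum>t<k. ?u i \<omega> t * ?x j \<omega> t)" for i j
    using k unit by (intro Bochner_Integration.integrable_sum integrable_rounded_mult_proj) auto
  have int2: "integrable ?P (\<lambda>\<omega>. \<Sum>t<k. ?x i \<omega> t * ?x j \<omega> t)" for i j
    using k unit by (intro Bochner_Integration.integrable_sum integrable_proj_mult) auto
  have sum_expand: "(\<Sum>t<k. ?d i \<omega> t * ?d j \<omega> t) = (\<Sum>t<k. ?u i \<omega> t * ?u j \<omega> t)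
      - b * (\<Sum>t<k. ?u i \<omega> t * ?x j \<omega> t) - b * (\<Sum>t<k. ?u j \<omega> t * ?x i \<omega> t)
      + alpha k * (\<Sum>t<k. ?x i \<omega> t * ?x j \<omega> t)" for i j \<omega>
    unfolding expand by (simp only: sum.distrib sum_subtractf sum_distrib_left)
  have intd: "integrable ?P (\<lambda>\<omega>. \<Sum>t<k. ?d i \<omega> t * ?d j \<omega> t)" for i j
    unfolding sum_expand using int1 int2 intA by (intro Bochner_Integration.integrable_add
        Bochner_Integration.integrable_diff Bochner_Integration.integrable_mult_right)
  have entry: "(A - alpha k *\<^sub>R X) $ i $ j = (\<integral>\<omega>. (\<Sum>t<k. ?d i \<omega> t * ?d j \<omega> t) \<partial>?P)" for i j
  proof -
    have "(\<integral>\<omega>. (\<Sum>t<k. ?d i \<omega> t * ?d j \<omega> t) \<partial>?P) =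
        A $ i $ j - b * (b * (s i \<bullet> s j)) - b * (b * (s j \<bullet> s i)) + alpha k * (s i \<bullet> s j)"
      unfolding sum_expand
      using int1 int2 intA integral_rounded_mult_proj[OF k unit unit] integral_proj_mult[OF k unit unit]
      by (simp add: A_def b_def Bochner_Integration.integral_add Bochner_Integration.integral_diff)
    also have "\<dots> = (A - alpha k *\<^sub>R X) $ i $ j"
      by (simp add: X_def inner_commute mult.assoc[symmetric] b2)
    finally show ?thesis by simp
  qed
  show "psd (A - alpha k *\<^sub>R X)"
    unfolding psd_def
  proof (intro conjI allI)
    show "transpose (A - alpha k *\<^sub>R X) = A - alpha k *\<^sub>R X"
      by (simp add: transpose_def vec_eq_iff A_def X_def inner_commute mult.commute)
    fix v :: "real^'n"
    \<comment> \<open>The quadratic form moves inside the expectation, where it is a sum of squares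
      for each sample.\<close>
    have "v \<bullet> ((A - alpha k *\<^sub>R X) *v v) =
        (\<integral>\<omega>. (\<Sum>i\<in>UNIV. \<Sum>j\<in>UNIV. (\<Sum>t<k. ?d i \<omega> t * ?d j \<omega> t) * v $ i * v $ j) \<partial>?P)"
      unfolding inner_matrix_vector_eq_sum entry using intd by simp
    also have "\<dots> = (\<integral>\<omega>. (\<Sum>t<k. (\<Sum>i\<in>UNIV. v $ i * ?d i \<omega> t)\<^sup>2) \<partial>?P)"
    proof (rule Bochner_Integration.integral_cong[OF refl])
      fix \<omega>
      have "(\<Sum>i\<in>UNIV. \<Sum>j\<in>UNIV. (\<Sum>t<k. ?d i \<omega> t * ?d j \<omega> t) * v $ i * v $ j) =
          (\<Sum>i\<in>UNIV. \<Sum>j\<in>UNIV. \<Sum>t<k. (v $ i * ?d i \<omega> t) * (v $ j * ?d j \<omega> t))"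
        by (intro sum.cong refl) (simp add: sum_distrib_left mult_ac)
      also have "\<dots> = (\<Sum>i\<in>UNIV. \<Sum>t<k. \<Sum>j\<in>UNIV. (v $ i * ?d i \<omega> t) * (v $ j * ?d j \<omega> t))"
        by (intro sum.cong refl sum.swap)
      also have "\<dots> = (\<Sum>t<k. \<Sum>i\<in>UNIV. \<Sum>j\<in>UNIV. (v $ i * ?d i \<omega> t) * (v $ j * ?d j \<omega> t))"
        by (rule sum.swap)
      finally show "(\<Sum>i\<in>UNIV. \<Sum>j\<in>UNIV. (\<Sum>t<k. ?d i \<omega> t * ?d j \<omega> t) * v $ i * v $ j) =
          (\<Sum>t<k. (\<Sum>i\<in>UNIV. v $ i * ?d i \<omega> t)\<^sup>2)"
        by (simp only: power2_eq_square sum_product)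
    qed
    also have "\<dots> \<ge> 0" by (intro Bochner_Integration.integral_nonneg sum_nonneg) simp
    finally show "0 \<le> v \<bullet> ((A - alpha k *\<^sub>R X) *v v)" .
  qed
qed

text \<open>The diagonal entry \<open>1 - alpha k\<close> of a positive semidefinite matrix is
  nonnegative; the one-by-one case is enough.\<close>

lemma alpha_le_1:
  assumes k: "k \<ge> 1"
  shows "alpha k \<le> 1"
proof -
  define s :: "1 \<Rightarrow> real^1" where "s = (\<lambda>_. axis 1 1)"
  have unit: "norm (s i) = 1" for i by (simp add: s_def)
  note cov = rounded_covariance[of k s, OF k unit]
  show ?thesis
    using psd_diag_nonneg[OF cov(3), of 1] cov(1)[of 1] unit[of 1] by (simp add: norm_eq_1)
qed

text \<open>Write \<open>A\<close> as \<open>alpha k *\<^sub>R X\<close> plus a positive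
  semidefinite remainder with diagonal \<open>1 - alpha k\<close>. Pairing the remainder with
  \<open>M\<close> loses at most \<open>(1 - alpha k) * SDP (- M)\<close>.\<close>

lemma OPT_ge_SDP:
  fixes M :: "real^'n^'n"
  assumes k: "k \<ge> 1"
  shows "alpha k * SDP M \<le> OPT k M + (1 - alpha k) * SDP (- M)"
proof -
  obtain X :: "real^'n^'n" where X: "X \<in> elliptope" "mat_inner M X = SDP M"
    using SDP_attained[of M] by blast
  then obtain s :: "'n \<Rightarrow> real^'n" where s: "\<And>i j. X $ i $ j = s i \<bullet> s j"
    using psd_gram[of X] by (auto simp: elliptope_def)
  have diag: "X $ i $ i = 1" for i using X(1) by (simp add: elliptope_def)
  then have unit: "norm (s i) = 1" for i using s by (simp add: norm_eq_1)
  have X_eq: "X = (\<chi> i j. s i \<bullet> s j)" by (simp add: vec_eq_iff s)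
  obtain A :: "real^'n^'n" where A: "\<And>i. A $ i $ i = 1" "mat_inner M A \<le> OPT k M" "psd (A - alpha k *\<^sub>R X)"
    using rounded_covariance[of k s, OF k unit] unfolding X_eq by blast
  have "mat_inner (- M) (A - alpha k *\<^sub>R X) \<le> (1 - alpha k) * SDP (- M)"
    by (rule mat_inner_psd_le_SDP[OF A(3)]) (simp add: A(1) diag)
  moreover have "mat_inner M A = mat_inner M (alpha k *\<^sub>R X) + mat_inner M (A - alpha k *\<^sub>R X)"
    unfolding mat_inner_add_right[symmetric] by simp
  ultimately show ?thesis
    using A(2) X(2) by (simp add: mat_inner_uminus_left mat_inner_scaleR_right)
qed

theorem theorem3p1:
  fixes M :: "real^'n^'n" and k :: nat
  assumes "k \<ge> 1" and "transpose M = M"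
  shows "SDP M \<ge> OPT k M \<and>
         OPT k M \<ge> alpha k * SDP M - (1 - alpha k) * SDP (- M) \<and>
         OPT k M \<ge> (2 - inverse (alpha k)) * SDP M - (inverse (alpha k) - 1) * OPT k (- M)"
proof (intro conjI)
  obtain X where "X \<in> elliptope" "mat_inner M X = OPT k M"
    using OPT_attained[OF assms(1), of M] by blast
  then show "OPT k M \<le> SDP M" using mat_inner_le_SDP by metis
  let ?a = "alpha k"
  note a = alpha_pos[OF assms(1)]
  show first: "?a * SDP M - (1 - ?a) * SDP (- M) \<le> OPT k M"
    using OPT_ge_SDP[OF assms(1), of M] by simp
  \<comment> \<open>The same bound for \<open>- M\<close> limits the error term
    \<open>SDP (- M)\<close> of the first inequality.\<close>
  have "?a * SDP (- M) \<le> OPT k (- M) + (1 - ?a) * SDP M"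
    using OPT_ge_SDP[OF assms(1), of "- M"] by simp
  then have "SDP (- M) \<le> inverse ?a * (OPT k (- M) + (1 - ?a) * SDP M)"
    using a by (simp add: field_simps)
  then have "(1 - ?a) * SDP (- M) \<le> (1 - ?a) * (inverse ?a * (OPT k (- M) + (1 - ?a) * SDP M))"
    using alpha_le_1[OF assms(1)] by (intro mult_left_mono) auto
  \<comment> \<open>The coefficient of \<open>SDP M\<close> is \<open>(1 - ?a)^2 / ?a\<close>, which
    equals \<open>?a - (2 - inverse ?a)\<close>. Its \<open>?a\<close> cancels against the leading
    term of the first bound.\<close>
  moreover have "(1 - ?a) * (inverse ?a * (OPT k (- M) + (1 - ?a) * SDP M)) =
      ?a * SDP M - (2 - inverse ?a) * SDP M + (inverse ?a - 1) * OPT k (- M)"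
    using a by (simp add: field_simps power2_eq_square)
  ultimately show "(2 - inverse ?a) * SDP M - (inverse ?a - 1) * OPT k (- M) \<le> OPT k M"
    using first by linarith
qed

end
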